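(* For any graph $G$ with diameter $d$, the total stress of $G$ is given by $$N_{\mathrm{str}}(G)=\sum_{i=1}^{d}(i-1)f_i,$$ where $f_i$ is the number of geodesics of length $i$ in $G$.
   Context: Graphs are finite, undirected and simple. The length of a path is its number of edges. A geodesic is a shortest path between two vertices (a path and its reverse are the same geodesic); it passes through a vertex $v$ if $v$ is an internal vertex of it. The diameter of $G$ is the length of a longest geodesic in $G$. The stress $\mathrm{str}(v)$ of a vertex $v$ is the number of geodesics in $G$ passing through $v$. The total stress of $G=(V,E)$ is $N_{\mathrm{str}}(G)=\sum_{v\in V}\mathrm{str}(v)$. *)

theory Defs
  imports "Graph_Theory.Vertex_Walk"
begin

text \<open>
  A finite simple undirected graph is an instance of the locale \<^locale>\<open>graph\<close>: a finite, loop-free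
  symmetric digraph without parallel arcs, so that an edge is a pair of opposite arcs.
  Graphs need not be connected.
\<close>

definition shortest_vpath :: "('a, 'b) pre_digraph \<Rightarrow> 'a vwalk \<Rightarrow> bool" where
  "shortest_vpath G p \<longleftrightarrow> vpath p G \<and>
     (\<forall>q. vpath q G \<and> hd q = hd p \<and> last q = last p \<longrightarrow> vwalk_length p \<le> vwalk_length q)"

text \<open>
  A path and its reverse are the same geodesic, so a geodesic is the set consisting of a shortest
  path and its reverse. One-vertex paths are included, as geodesics of length 0.
\<close>

definition geodesics :: "('a, 'b) pre_digraph \<Rightarrow> 'a vwalk set set" where
  "geodesics G = {{p, rev p} | p. shortest_vpath G p}"

definition geodesic_length :: "'a vwalk set \<Rightarrow> nat" where
  "geodesic_length g = the_elem (vwalk_length ` g)"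

lemma geodesic_length_pair: "geodesic_length {p, rev p} = vwalk_length p"
  by (simp add: geodesic_length_def)

definition internal_verts :: "'a vwalk \<Rightarrow> 'a set" where
  "internal_verts p = set (butlast (tl p))"

lemma internal_verts_rev: "internal_verts (rev p) = internal_verts p"
  unfolding internal_verts_def by (metis butlast_rev butlast_tl rev_rev_ident set_rev)

text \<open>By \<open>internal_verts_rev\<close>, either orientation may be used.\<close>

definition passes_through :: "'a vwalk set \<Rightarrow> 'a \<Rightarrow> bool" where
  "passes_through g v \<longleftrightarrow> (\<exists>p\<in>g. v \<in> internal_verts p)"

text \<open>For the graph without vertices there are no geodesics and this maximum is unspecified.\<close>

definition graph_diameter :: "('a, 'b) pre_digraph \<Rightarrow> nat" where
  "graph_diameter G = Max (geodesic_length ` geodesics G)"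

definition stress :: "('a, 'b) pre_digraph \<Rightarrow> 'a \<Rightarrow> nat" where
  "stress G v = card {g \<in> geodesics G. passes_through g v}"

definition total_stress :: "('a, 'b) pre_digraph \<Rightarrow> nat" where
  "total_stress G = (\<Sum>v\<in>verts G. stress G v)"

definition num_geodesics :: "('a, 'b) pre_digraph \<Rightarrow> nat \<Rightarrow> nat" where
  "num_geodesics G i = card {g \<in> geodesics G. geodesic_length g = i}"

end

theory Submission
  imports Defs
begin

text \<open>
  The identity is a double count of the pairs of a geodesic and a vertex that it passes through.
  Counted by vertices, these pairs number the total stress. Counted by geodesics, a geodesic of
  length \<open>i \<ge> 1\<close> contributes its internal vertices, and there are exactly \<open>i - 1\<close> of them, because the
  \<open>i + 1\<close> vertices of a path are distinct and two of them are its ends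
  (\<open>card_passed_through\<close>). Grouping the geodesics by length then gives the formula. The
  group of length \<open>0\<close> (single vertices) is absent from the right-hand side; its geodesics have no
  internal vertices, in agreement with truncated subtraction, where \<open>0 - 1 = 0\<close>.
\<close>

lemma geodesicsE:
  assumes "g \<in> geodesics G"
  obtains p where "g = {p, rev p}" and "vpath p G"
  using assms unfolding geodesics_def shortest_vpath_def by blast

lemma (in fin_digraph) finite_geodesics: "finite (geodesics G)"
proof -
  have "geodesics G \<subseteq> (\<lambda>p. {p, rev p}) ` {p. vpath p G}"
    by (auto elim: geodesicsE)
  then show ?thesis
    using vpaths_finite by (rule finite_surj[rotated])
qed

lemma passes_through_pair: "passes_through {p, rev p} v \<longleftrightarrow> v \<in> internal_verts p"
  by (simp add: passes_through_def internal_verts_rev)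

lemma internal_verts_subset: "internal_verts p \<subseteq> set p"
  unfolding internal_verts_def by (cases p) (auto dest: in_set_butlastD)

lemma card_internal_verts:
  assumes "distinct p"
  shows "card (internal_verts p) = vwalk_length p - 1"
  using assms by (simp add: internal_verts_def distinct_card distinct_butlast distinct_tl)

lemma card_passed_through:
  assumes "g \<in> geodesics G"
  shows "card {v \<in> verts G. passes_through g v} = geodesic_length g - 1"
proof -
  obtain p where g: "g = {p, rev p}" and p: "vpath p G"
    using assms by (rule geodesicsE)
  have "internal_verts p \<subseteq> verts G"
    using p internal_verts_subset[of p] by (auto simp: vpath_def vwalk_def)
  then have "{v \<in> verts G. passes_through g v} = internal_verts p"
    by (auto simp: g passes_through_pair)
  then show ?thesis
    using p by (simp only: g geodesic_length_pair card_internal_verts vpath_def)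
qed

lemma (in fin_digraph) total_stress_eq_sum_geodesics:
  "total_stress G = (\<Sum>g\<in>geodesics G. geodesic_length g - 1)"
proof -
  have "total_stress G = (\<Sum>v\<in>verts G. \<Sum>g | g \<in> geodesics G \<and> passes_through g v. 1)"
    by (simp add: total_stress_def stress_def)
  also have "\<dots> = (\<Sum>g\<in>geodesics G. \<Sum>v | v \<in> verts G \<and> passes_through g v. 1)"
    by (rule sum.swap_restrict[OF finite_verts finite_geodesics])
  also have "\<dots> = (\<Sum>g\<in>geodesics G. geodesic_length g - 1)"
    by (simp add: card_passed_through)
  finally show ?thesis .
qed

theorem proposition2p6:
  fixes G :: "('a, 'b) pre_digraph" and d :: nat
  assumes "graph G" and "graph_diameter G = d"
  shows "total_stress G = (\<Sum>i = 1..d. (i - 1) * num_geodesics G i)"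
proof -
  interpret graph G by fact
  have "geodesic_length ` geodesics G \<subseteq> {0..d}"
    using assms(2) finite_geodesics by (auto simp: graph_diameter_def)
  then have "(\<Sum>g\<in>geodesics G. geodesic_length g - 1)
      = (\<Sum>i = 0..d. \<Sum>g | g \<in> geodesics G \<and> geodesic_length g = i. geodesic_length g - 1)"
    by (intro sum.group[symmetric] finite_geodesics) simp_all
  also have "\<dots> = (\<Sum>i = 0..d. (i - 1) * num_geodesics G i)"
    by (simp add: num_geodesics_def mult.commute)
  also have "\<dots> = (\<Sum>i = 1..d. (i - 1) * num_geodesics G i)"
    by (simp add: sum.atLeast_Suc_atMost)
  finally show ?thesis
    by (simp only: total_stress_eq_sum_geodesics)
qed

end
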